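(* Let $\mathcal S$ be the set of Arf sequences and let $\mathcal A$ be the set of all Arf numerical semigroups. The mapping $$\mathrm S:\mathcal S\to\mathcal A\setminus\{\mathbb N\},\qquad (x_1,\ldots,x_n)\mapsto \mathrm S(x_1,\ldots,x_n)$$ is a bijection, and its inverse is the map $S\mapsto (\mathrm m(\mathrm L^n(S)),\mathrm m(\mathrm L^{n-1}(S)),\ldots,\mathrm m(S))$, where $n$ is the nonnegative integer (depending on $S$) such that $\mathrm L^n(S)\subsetneq \mathrm L^{n+1}(S)=\mathbb N$.
   Context: $\mathbb N$ denotes the set of nonnegative integers. A numerical semigroup is a submonoid $S$ of $(\mathbb N,+)$ with finite complement in $\mathbb N$. Its multiplicity $\mathrm m(S)$ is the least positive integer in $S$. $S$ is an Arf numerical semigroup if $x+y-z\in S$ for all $x,y,z\in S$ with $x\ge y\ge z$ (equivalently $2x-y\in S$ for all $x\ge y$ in $S$). An Arf sequence is a finite sequence of integers $(x_1,\ldots,x_n)$, $n\ge 1$, such that $x_n\ge\cdots\ge x_1\ge 2$ and, for every $i\in\{1,\ldots,n-1\}$, $x_{i+1}\in\{x_i,\,x_i+x_{i-1},\ldots,x_i+\cdots+x_1,\to\}$, where the arrow $\to$ after the last listed integer means that all integers larger than it belong to the set. For an Arf sequence $(x_1,\ldots,x_n)$, put $\mathrm S(x_1,\ldots,x_n)=\{0,x_n,x_n+x_{n-1},\ldots,x_n+\cdots+x_1,\to\}$ (an Arf numerical semigroup). For a numerical semigroup $S$ with $M=S\setminus\{0\}$, the Lipman semigroup is $\mathrm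 L(S)=\bigcup_{k\ge 1}\{z\in\mathbb Z\mid z+kM\subseteq kM\}$, where $kM=\{i_1+\cdots+i_k\mid i_1,\ldots,i_k\in M\}$; equivalently, if $n_1<\cdots<n_e$ are the minimal generators of $S$, then $\mathrm L(S)=\langle n_1,n_2-n_1,\ldots,n_e-n_1\rangle$, the submonoid of $\mathbb N$ generated by these integers. Set $\mathrm L^0(S)=S$ and $\mathrm L^i(S)=\mathrm L(\mathrm L^{i-1}(S))$ for $i\ge 1$. *)

theory Defs
  imports Main
begin

definition numerical_semigroup :: "nat set \<Rightarrow> bool" where
  "numerical_semigroup S \<longleftrightarrow>
     0 \<in> S \<and> (\<forall>x\<in>S. \<forall>y\<in>S. x + y \<in> S) \<and> finite (UNIV - S)"

definition multiplicity :: "nat set \<Rightarrow> nat" where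
  "multiplicity S = (LEAST x. 0 < x \<and> x \<in> S)"

(* The natural-number subtraction never truncates here, because z \<le> y. *)
definition arf_numerical_semigroup :: "nat set \<Rightarrow> bool" where
  "arf_numerical_semigroup S \<longleftrightarrow>
     numerical_semigroup S \<and>
     (\<forall>x\<in>S. \<forall>y\<in>S. \<forall>z\<in>S. y \<le> x \<and> z \<le> y \<longrightarrow> x + y - z \<in> S)"

(* For xs = [x_1, ..., x_i] this is {x_i, x_i + x_(i-1), ..., x_i + ... + x_1, \<rightarrow>}:
   sum_list (drop j xs) is x_i + ... + x_(j+1). *)
definition tail_sums :: "nat list \<Rightarrow> nat set" where
  "tail_sums xs = {sum_list (drop j xs) | j. j < length xs} \<union> {sum_list xs <..}"

(* Entries of an Arf sequence are integers \<ge> 2, so lists of naturals lose nothing.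
   Lists are indexed from 0: xs ! i is x_(i+1) and take i xs is [x_1, ..., x_i]. *)
definition arf_sequence :: "nat list \<Rightarrow> bool" where
  "arf_sequence xs \<longleftrightarrow>
     xs \<noteq> [] \<and> sorted xs \<and> 2 \<le> hd xs \<and>
     (\<forall>i. 1 \<le> i \<and> i < length xs \<longrightarrow> xs ! i \<in> tail_sums (take i xs))"

definition semigroup_of :: "nat list \<Rightarrow> nat set" where
  "semigroup_of xs = {0} \<union> tail_sums xs"

definition fold_sumset :: "nat \<Rightarrow> nat set \<Rightarrow> nat set" where
  "fold_sumset k M = {sum_list is | is. length is = k \<and> set is \<subseteq> M}"

definition lipman_int :: "nat set \<Rightarrow> int set" where
  "lipman_int S =
     (\<Union>k\<in>{1..}. {z. (\<lambda>i. z + int i) ` fold_sumset k (S - {0}) \<subseteq> int ` fold_sumset k (S - {0})})"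

(* The same set viewed inside the naturals, so that the construction can be iterated;
   lipman_int_eq shows that no element is lost. *)
definition lipman :: "nat set \<Rightarrow> nat set" where
  "lipman S = {n. int n \<in> lipman_int S}"

lemma lipman_int_eq:
  assumes "numerical_semigroup S"
  shows "lipman_int S = int ` lipman S"
proof -
  have nonneg: "0 \<le> z" if z: "z \<in> lipman_int S" for z
  proof -
    obtain k where k: "(\<lambda>i. z + int i) ` fold_sumset k (S - {0}) \<subseteq> int ` fold_sumset k (S - {0})"
      using z unfolding lipman_int_def by blast
    have "infinite S"
      using assms finite_Diff2[of S UNIV] infinite_UNIV_nat unfolding numerical_semigroup_def by blast
    then have "infinite (S - {0})" by simp
    then obtain m where m: "m \<in> S - {0}" using infinite_imp_nonempty by blast
    have "sum_list (replicate k m) \<in> fold_sumset k (S - {0})"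
      unfolding fold_sumset_def using m by (intro CollectI exI[of _ "replicate k m"]) auto
    then have a: "(LEAST a. a \<in> fold_sumset k (S - {0})) \<in> fold_sumset k (S - {0})"
      by (rule LeastI)
    have le: "(LEAST a. a \<in> fold_sumset k (S - {0})) \<le> b" if "b \<in> fold_sumset k (S - {0})" for b
      using that by (rule Least_le)
    obtain b where "b \<in> fold_sumset k (S - {0})" "z + int (LEAST a. a \<in> fold_sumset k (S - {0})) = int b"
      using k a by blast
    with le[of b] show ?thesis by linarith
  qed
  show ?thesis
  proof (intro set_eqI iffI)
    fix z assume z: "z \<in> lipman_int S"
    then have eq: "z = int (nat z)" using nonneg by simp
    have "nat z \<in> lipman S" using z eq unfolding lipman_def by simp
    with eq show "z \<in> int ` lipman S" by (rule image_eqI)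
  qed (auto simp: lipman_def)
qed

end

(* Everything rests on one step: in an Arf semigroup S of multiplicity m one has
   kM = (k-1)m + M for M = S - {0}, so L(S) = {x - m | x in M}, and S is recovered from L(S) and m as
   {0} \<union> (m + L(S)). On sequences this step is appending or removing the last entry, since
   S(x_1, ..., x_n, m) = {0} \<union> (m + S(x_1, ..., x_n)), where the empty sequence stands for the
   full semigroup of natural numbers. *)
theory Submission
  imports Defs
begin

section \<open>Arf sequences\<close>

text \<open>The empty list is not an Arf sequence. Its value serves as the base case of the
  inductions and as the end point of iterating \<open>lipman\<close>.\<close>

lemma semigroup_of_Nil [simp]: "semigroup_of [] = UNIV"
  by (auto simp: semigroup_of_def tail_sums_def)

text \<open>A nonempty suffix of \<open>ys @ [m]\<close> is a suffix of \<open>ys\<close> followed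
  by \<open>m\<close>. The suffix \<open>[m]\<close> alone corresponds to the element 0 of
  \<open>semigroup_of ys\<close>, and the final ray is shifted by \<open>m\<close>.\<close>

lemma tail_sums_snoc: "tail_sums (ys @ [m]) = (+) m ` semigroup_of ys"
proof -
  have "{sum_list (drop j (ys @ [m])) | j. j < length (ys @ [m])}
      = insert m ((+) m ` {sum_list (drop j ys) | j. j < length ys})"
    by (force simp: less_Suc_eq add.commute)
  moreover have "{sum_list (ys @ [m]) <..} = (+) m ` {sum_list ys <..}"
  proof -
    have "x \<in> (+) m ` {sum_list ys <..}" if "sum_list ys + m < x" for x
      using that by (intro image_eqI[of _ _ "x - m"]) auto
    then show ?thesis by auto
  qed
  ultimately show ?thesis
    unfolding tail_sums_def semigroup_of_def by (simp add: image_Un)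
qed

lemma semigroup_of_snoc: "semigroup_of (ys @ [m]) = insert 0 ((+) m ` semigroup_of ys)"
  by (simp add: semigroup_of_def[of "ys @ [m]"] tail_sums_snoc)

text \<open>Every listed sum runs over a nonempty suffix, hence includes the last entry. This makes
  sortedness automatic when an entry is appended.\<close>

lemma last_le_tail_sums:
  assumes "ys \<noteq> []" "x \<in> tail_sums ys"
  shows "last ys \<le> x"
proof (cases "sum_list ys < x")
  case True
  have "last ys \<le> sum_list ys"
    using assms(1) by (simp add: member_le_sum_list)
  with True show ?thesis by simp
next
  case False
  then obtain j where "j < length ys" "x = sum_list (drop j ys)"
    using assms(2) by (auto simp: tail_sums_def)
  moreover from this have "last ys \<in> set (drop j ys)"
    by (metis drop_eq_Nil last_drop last_in_set not_le)
  ultimately show ?thesis by (simp add: member_le_sum_list)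
qed

lemma arf_sequence_last_ge_2:
  assumes "arf_sequence ys"
  shows "2 \<le> last ys"
proof -
  have "hd ys \<le> last ys"
    using assms by (cases ys) (auto simp: arf_sequence_def)
  then show ?thesis using assms by (simp add: arf_sequence_def)
qed

text \<open>The recursive form of the definition used in all inductions. Since
  \<open>2 \<le> m\<close> rules out 0, membership in \<open>semigroup_of ys\<close> amounts to
  membership in \<open>tail_sums ys\<close>, and this bounds \<open>m\<close> below by all earlier
  entries.\<close>

lemma arf_sequence_snoc:
  "arf_sequence (ys @ [m]) \<longleftrightarrow>
     2 \<le> m \<and> m \<in> semigroup_of ys \<and> (ys = [] \<or> arf_sequence ys)"
proof (cases "ys = []")
  case True
  then show ?thesis by (auto simp: arf_sequence_def)
next
  case False
  \<comment> \<open>The index \<open>length ys\<close>, which is at least 1, gives the condition on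
    \<open>m\<close>; smaller indices see only \<open>ys\<close>.\<close>
  have nth: "(\<forall>i. 1 \<le> i \<and> i < length (ys @ [m]) \<longrightarrow> (ys @ [m]) ! i \<in> tail_sums (take i (ys @ [m])))
      \<longleftrightarrow> m \<in> tail_sums ys \<and> (\<forall>i. 1 \<le> i \<and> i < length ys \<longrightarrow> ys ! i \<in> tail_sums (take i ys))"
    using False by (auto simp: less_Suc_eq nth_append Suc_le_eq)
  have srt: "sorted (ys @ [m])" if "sorted ys" "m \<in> tail_sums ys"
  proof -
    have "x \<le> m" if "x \<in> set ys" for x
    proof -
      have "x \<le> last ys"
        using that \<open>sorted ys\<close> False
        by (auto simp: in_set_conv_nth last_conv_nth intro: sorted_nth_mono)
      then show ?thesis using last_le_tail_sums[OF False \<open>m \<in> tail_sums ys\<close>] by simp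
    qed
    then show ?thesis using \<open>sorted ys\<close> by (simp add: sorted_append)
  qed
  have "m \<in> tail_sums ys \<longleftrightarrow> 2 \<le> m \<and> m \<in> semigroup_of ys" if "arf_sequence ys"
    using last_le_tail_sums[OF False, of m] arf_sequence_last_ge_2[OF that]
    by (auto simp: semigroup_of_def)
  moreover have "arf_sequence (ys @ [m]) \<longleftrightarrow> arf_sequence ys \<and> m \<in> tail_sums ys"
    using False srt unfolding arf_sequence_def nth by (auto simp: sorted_append)
  ultimately show ?thesis using False by auto
qed

section \<open>Arf semigroups and the Lipman semigroup\<close>

text \<open>The last fact needs no order between x and y, because x + y - z is symmetric in
  them.\<close>

lemma arf_numerical_semigroupD:
  assumes "arf_numerical_semigroup S"
  shows "0 \<in> S" "\<And>x y. x \<in> S \<Longrightarrow> y \<in> S \<Longrightarrow> x + y \<in> S" "finite (UNIV - S)"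
    "\<And>x y z. x \<in> S \<Longrightarrow> y \<in> S \<Longrightarrow> z \<in> S \<Longrightarrow> z \<le> x \<Longrightarrow> z \<le> y \<Longrightarrow> x + y - z \<in> S"
proof -
  have S: "numerical_semigroup S"
    "\<forall>x\<in>S. \<forall>y\<in>S. \<forall>z\<in>S. y \<le> x \<and> z \<le> y \<longrightarrow> x + y - z \<in> S"
    using assms unfolding arf_numerical_semigroup_def by simp_all
  then show "0 \<in> S" "\<And>x y. x \<in> S \<Longrightarrow> y \<in> S \<Longrightarrow> x + y \<in> S" "finite (UNIV - S)"
    unfolding numerical_semigroup_def by simp_all
  show "x + y - z \<in> S" if "x \<in> S" "y \<in> S" "z \<in> S" "z \<le> x" "z \<le> y" for x y z
    using S(2) that by (metis add.commute linear)
qed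

lemma arf_numerical_semigroup_imp_numerical_semigroup:
  "arf_numerical_semigroup S \<Longrightarrow> numerical_semigroup S"
  by (simp add: arf_numerical_semigroup_def)

lemma multiplicity_mem:
  assumes "numerical_semigroup S"
  shows "0 < multiplicity S" "multiplicity S \<in> S"
proof -
  have "infinite S"
    using assms finite_Diff2[of S UNIV] infinite_UNIV_nat
    unfolding numerical_semigroup_def by blast
  then have "S - {0} \<noteq> {}"
    by (metis finite.emptyI finite_Diff_insert Diff_empty)
  then have "\<exists>x. 0 < x \<and> x \<in> S" by auto
  then have "0 < multiplicity S \<and> multiplicity S \<in> S"
    unfolding multiplicity_def by (rule LeastI_ex)
  then show "0 < multiplicity S" "multiplicity S \<in> S" by auto
qed

lemma multiplicity_le: "x \<in> S \<Longrightarrow> 0 < x \<Longrightarrow> multiplicity S \<le> x"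
  unfolding multiplicity_def by (simp add: Least_le)

section \<open>Sumsets kM and the Lipman semigroup in the Arf case\<close>

lemma fold_sumset_Suc:
  "fold_sumset (Suc k) M = {x + y | x y. x \<in> M \<and> y \<in> fold_sumset k M}"
proof (intro set_eqI iffI)
  fix z assume "z \<in> fold_sumset (Suc k) M"
  then obtain x xs where "z = x + sum_list xs" "x \<in> M" "length xs = k" "set xs \<subseteq> M"
    by (auto simp: fold_sumset_def length_Suc_conv)
  then show "z \<in> {x + y | x y. x \<in> M \<and> y \<in> fold_sumset k M}"
    by (auto simp: fold_sumset_def)
next
  fix z assume "z \<in> {x + y | x y. x \<in> M \<and> y \<in> fold_sumset k M}"
  then obtain x xs where "z = sum_list (x # xs)" "length (x # xs) = Suc k" "set (x # xs) \<subseteq> M"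
    by (auto simp: fold_sumset_def)
  then show "z \<in> fold_sumset (Suc k) M"
    unfolding fold_sumset_def by blast
qed

lemma fold_sumset_0: "fold_sumset 0 M = {0}"
  by (auto simp: fold_sumset_def)

text \<open>For x, y in M the Arf property puts x + y - m in M, so M + M = m + M. Induction then
  gives a translate of M for every multiple.\<close>

lemma fold_sumset_arf:
  assumes "arf_numerical_semigroup S"
  shows "fold_sumset (Suc k) (S - {0}) = (+) (k * multiplicity S) ` (S - {0})"
proof (induction k)
  case 0
  show ?case by (auto simp: fold_sumset_Suc fold_sumset_0)
next
  case (Suc k)
  define m where "m = multiplicity S"
  have m: "0 < m" "m \<in> S"
    using multiplicity_mem[OF arf_numerical_semigroup_imp_numerical_semigroup[OF assms]]
    by (simp_all add: m_def)
  have "x + y - m \<in> S - {0}" "m \<le> x + y" if "x \<in> S - {0}" "y \<in> S - {0}" for x y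
  proof -
    have "m \<le> x" "m \<le> y" using that by (auto simp: m_def multiplicity_le)
    then show "x + y - m \<in> S - {0}" "m \<le> x + y"
      using m that arf_numerical_semigroupD(4)[OF assms, of x y m] by auto
  qed
  then have "x + (k * m + y) \<in> (+) (Suc k * m) ` (S - {0})"
    if "x \<in> S - {0}" "y \<in> S - {0}" for x y
    using that by (intro image_eqI[of _ _ "x + y - m"]) simp_all
  moreover have "\<exists>x y. Suc k * m + z = x + y \<and> x \<in> S - {0} \<and> y \<in> (+) (k * m) ` (S - {0})"
    if "z \<in> S - {0}" for z
    using that m by (intro exI[of _ m] exI[of _ "k * m + z"]) auto
  ultimately have "{x + y | x y. x \<in> S - {0} \<and> y \<in> (+) (k * m) ` (S - {0})}
      = (+) (Suc k * m) ` (S - {0})"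
    by blast
  then show ?case
    using Suc.IH unfolding m_def by (simp only: fold_sumset_Suc[of "Suc k"])
qed

text \<open>Since each kM is a translate of M, stability of kM under adding z means z + M is
  contained in M, whatever k is. It suffices to test the element m, because z + x = (z + m) + x -
  m.\<close>

lemma lipman_arf:
  assumes "arf_numerical_semigroup S"
  shows "lipman S = {z. z + multiplicity S \<in> S}"
proof -
  define m where "m = multiplicity S"
  have m: "0 < m" "m \<in> S"
    using multiplicity_mem[OF arf_numerical_semigroup_imp_numerical_semigroup[OF assms]]
    by (simp_all add: m_def)
  \<comment> \<open>Translation by c and the embedding into the integers are injective, so both
    cancel from the inclusion.\<close>
  have shift: "(\<lambda>i. int z + int i) ` ((+) c ` M) \<subseteq> int ` ((+) c ` M) \<longleftrightarrow> (\<forall>x\<in>M. z + x \<in> M)"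
    for z c :: nat and M :: "nat set"
  proof -
    have "(\<lambda>i. int z + int i) ` ((+) c ` M) = int ` (+) c ` (+) z ` M"
      by (simp add: image_image algebra_simps)
    moreover have "int ` (+) c ` (+) z ` M \<subseteq> int ` (+) c ` M \<longleftrightarrow> (+) z ` M \<subseteq> M"
      by (simp add: inj_image_subset_iff)
    ultimately show ?thesis by auto
  qed
  have "z \<in> lipman S \<longleftrightarrow> (\<forall>x\<in>S - {0}. z + x \<in> S - {0})" for z
  proof -
    have "z \<in> lipman S \<longleftrightarrow> (\<exists>k. (\<lambda>i. int z + int i) ` fold_sumset (Suc k) (S - {0})
        \<subseteq> int ` fold_sumset (Suc k) (S - {0}))"
      unfolding lipman_def lipman_int_def by (auto simp: Bex_def gr0_conv_Suc Suc_le_eq)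
    then show ?thesis
      by (simp only: fold_sumset_arf[OF assms] shift simp_thms)
  qed
  also have "(\<forall>x\<in>S - {0}. z + x \<in> S - {0}) \<longleftrightarrow> z + m \<in> S" for z
  proof
    assume zm: "z + m \<in> S"
    show "\<forall>x\<in>S - {0}. z + x \<in> S - {0}"
    proof
      fix x assume x: "x \<in> S - {0}"
      then have "m \<le> x" by (simp add: m_def multiplicity_le)
      then have "z + m + x - m \<in> S"
        using arf_numerical_semigroupD(4)[OF assms zm _ m(2)] x by simp
      with x show "z + x \<in> S - {0}" by simp
    qed
  qed (use m in auto)
  finally show ?thesis by (auto simp: m_def)
qed

section \<open>Passing from S to {0} together with m + S, and back\<close>

lemma arf_numerical_semigroup_UNIV: "arf_numerical_semigroup UNIV"
  by (simp add: arf_numerical_semigroup_def numerical_semigroup_def)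

text \<open>The hypothesis \<open>m \<in> S\<close> gives closure under addition: (m + a) + (m + b)
  = m + (m + a + b). The Arf property is inherited through (m + a) + (m + b) - (m + c) = m + (a + b
  - c).\<close>

lemma arf_numerical_semigroup_insert:
  assumes "arf_numerical_semigroup S" "m \<in> S"
  shows "arf_numerical_semigroup (insert 0 ((+) m ` S))" (is "arf_numerical_semigroup ?T")
proof -
  note S = arf_numerical_semigroupD[OF assms(1)]
  have "x + y \<in> ?T" if xy: "x \<in> ?T" "y \<in> ?T" for x y
  proof (cases "x = 0 \<or> y = 0")
    case False
    then have "x \<in> (+) m ` S" "y \<in> (+) m ` S" using xy by simp_all
    then obtain a b where "x = m + a" "y = m + b" "a \<in> S" "b \<in> S"
      by (elim imageE)
    then have "x + y = m + (m + a + b)" "m + a + b \<in> S" using S(2) assms(2) by simp_all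
    then show ?thesis by (metis image_eqI insertI2)
  qed (use xy in auto)
  moreover from this have "x + y - z \<in> ?T"
    if "x \<in> ?T" "y \<in> ?T" "z \<in> ?T" "y \<le> x" "z \<le> y" for x y z
  proof (cases "z = 0")
    case False
    \<comment> \<open>From 0 < z and z \<le> y \<le> x none of the three is 0. The case z = 0 is
      closure under addition.\<close>
    with that have "x \<in> (+) m ` S" "y \<in> (+) m ` S" "z \<in> (+) m ` S" by auto
    then obtain a b c where abc: "x = m + a" "y = m + b" "z = m + c" "a \<in> S" "b \<in> S" "c \<in> S"
      by (elim imageE)
    then have "x + y - z = m + (a + b - c)" "a + b - c \<in> S"
      using S(4)[of a b c] \<open>y \<le> x\<close> \<open>z \<le> y\<close> by simp_all
    then show ?thesis by (metis image_eqI insertI2)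
  qed (use that in auto)
  moreover have "finite (UNIV - ?T)"
  proof (rule finite_subset)
    \<comment> \<open>A gap above m is m plus a gap of S.\<close>
    show "UNIV - ?T \<subseteq> {..m} \<union> (+) m ` (UNIV - S)"
    proof
      fix x assume x: "x \<in> UNIV - ?T"
      show "x \<in> {..m} \<union> (+) m ` (UNIV - S)"
      proof (cases "x \<le> m")
        case False
        then have "x = m + (x - m)" by simp
        with x have "x - m \<in> UNIV - S" by auto
        with \<open>x = m + (x - m)\<close> show ?thesis by blast
      qed simp
    qed
  qed (use S(3) in simp)
  ultimately show ?thesis
    unfolding arf_numerical_semigroup_def numerical_semigroup_def
    by (intro conjI ballI impI) (simp_all only: insertI1)
qed

lemma multiplicity_insert:
  assumes "0 \<in> S" "0 < m"
  shows "multiplicity (insert 0 ((+) m ` S)) = m"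
  unfolding multiplicity_def using assms by (intro Least_equality) auto

lemma lipman_insert:
  assumes "arf_numerical_semigroup S" "m \<in> S" "0 < m"
  shows "lipman (insert 0 ((+) m ` S)) = S"
proof -
  have "z + m \<in> insert 0 ((+) m ` S) \<longleftrightarrow> z \<in> S" for z
    using assms(3) by (simp add: add.commute[of z] inj_image_mem_iff)
  then show ?thesis
    by (simp add: lipman_arf arf_numerical_semigroup_insert assms multiplicity_insert
        arf_numerical_semigroupD(1)[OF assms(1)])
qed

lemma lipman_UNIV [simp]: "lipman UNIV = UNIV"
  by (simp add: lipman_arf[OF arf_numerical_semigroup_UNIV])

text \<open>The converse of \<open>lipman_insert\<close>: every nonzero x in S is at least m, and x
  - m lies in L(S), so S is rebuilt from L(S) and m.\<close>

lemma arf_numerical_semigroup_lipman: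
  assumes "arf_numerical_semigroup S"
  shows "arf_numerical_semigroup (lipman S)" "multiplicity S \<in> lipman S"
    "S = insert 0 ((+) (multiplicity S) ` lipman S)" "S \<subseteq> lipman S"
proof -
  define m where "m = multiplicity S"
  note S = arf_numerical_semigroupD[OF assms]
  have m: "0 < m" "m \<in> S"
    using multiplicity_mem[OF arf_numerical_semigroup_imp_numerical_semigroup[OF assms]]
    by (simp_all add: m_def)
  have L: "lipman S = {z. z + m \<in> S}"
    using lipman_arf[OF assms] by (simp add: m_def)
  show sub: "S \<subseteq> lipman S" using S(2) m L by auto
  then show "multiplicity S \<in> lipman S" using m by (auto simp: m_def)
  have "x \<in> (+) m ` lipman S" if "x \<in> S" "x \<noteq> 0" for x
  proof -
    have "m \<le> x" using that by (simp add: m_def multiplicity_le)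
    then show ?thesis using that L by (intro image_eqI[of _ _ "x - m"]) auto
  qed
  then show "S = insert 0 ((+) (multiplicity S) ` lipman S)"
    using S(1) L by (auto simp: m_def add.commute)
  \<comment> \<open>Apply the Arf property of S to x + m, y + m and m; for the Arf property of L(S),
    replace the last one by z + m.\<close>
  have "x + y \<in> lipman S" if "x \<in> lipman S" "y \<in> lipman S" for x y
    using that S(4)[of "x + m" "y + m" m] m L by (auto simp: algebra_simps)
  moreover have "x + y - z \<in> lipman S"
    if "x \<in> lipman S" "y \<in> lipman S" "z \<in> lipman S" "y \<le> x" "z \<le> y" for x y z
  proof -
    have "x + m + (y + m) - (z + m) = x + y - z + m" using that by simp
    then show ?thesis
      using that S(4)[of "x + m" "y + m" "z + m"] L by auto
  qed
  moreover have "finite (UNIV - lipman S)"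
    using S(3) sub by (rule_tac finite_subset[of _ "UNIV - S"]) auto
  ultimately show "arf_numerical_semigroup (lipman S)"
    unfolding arf_numerical_semigroup_def numerical_semigroup_def
    by (intro conjI ballI impI) (use sub S(1) in \<open>auto simp only:\<close>)
qed

text \<open>The witness is the Frobenius number F, the largest gap: F + m exceeds F, so it lies in
  S, which puts F in L(S).\<close>

lemma lipman_strict:
  assumes "arf_numerical_semigroup S" "S \<noteq> UNIV"
  shows "S \<subset> lipman S"
proof -
  define F where "F = Max (UNIV - S)"
  have fin: "finite (UNIV - S)" "UNIV - S \<noteq> {}"
    using assms arf_numerical_semigroupD(3) by auto
  have "F \<notin> S" using Max_in[OF fin] by (simp add: F_def)
  moreover have "F + multiplicity S \<in> S"
  proof (rule ccontr)
    assume "F + multiplicity S \<notin> S"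
    then have "F + multiplicity S \<le> F" using Max_ge[OF fin(1), of "F + multiplicity S"] by (simp add: F_def)
    then show False
      using multiplicity_mem(1)[OF arf_numerical_semigroup_imp_numerical_semigroup[OF assms(1)]]
      by simp
  qed
  then have "F \<in> lipman S" by (simp add: lipman_arf[OF assms(1)])
  ultimately show ?thesis using arf_numerical_semigroup_lipman(4)[OF assms(1)] by blast
qed

section \<open>The correspondence\<close>

lemma arf_numerical_semigroup_semigroup_of:
  "arf_sequence xs \<Longrightarrow> arf_numerical_semigroup (semigroup_of xs)"
proof (induction xs rule: rev_induct)
  case Nil
  then show ?case by (simp add: arf_numerical_semigroup_UNIV)
next
  case (snoc m ys)
  then have "m \<in> semigroup_of ys" "arf_numerical_semigroup (semigroup_of ys)"
    by (auto simp: arf_sequence_snoc arf_numerical_semigroup_UNIV)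
  then show ?case
    by (simp add: semigroup_of_snoc arf_numerical_semigroup_insert)
qed

lemma
  assumes "arf_sequence (ys @ [m])"
  shows lipman_semigroup_of_snoc: "lipman (semigroup_of (ys @ [m])) = semigroup_of ys"
    and multiplicity_semigroup_of_snoc: "multiplicity (semigroup_of (ys @ [m])) = m"
proof -
  have *: "m \<in> semigroup_of ys" "2 \<le> m" "arf_numerical_semigroup (semigroup_of ys)"
    using assms arf_numerical_semigroup_semigroup_of
    by (auto simp: arf_sequence_snoc arf_numerical_semigroup_UNIV)
  show "lipman (semigroup_of (ys @ [m])) = semigroup_of ys"
    using * by (simp add: semigroup_of_snoc lipman_insert)
  show "multiplicity (semigroup_of (ys @ [m])) = m"
    using * by (simp add: semigroup_of_snoc multiplicity_insert arf_numerical_semigroupD(1))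
qed

text \<open>The multiplicity is the last entry, hence at least 2, whereas \<open>UNIV\<close> has
  multiplicity 1.\<close>

lemma semigroup_of_ne_UNIV:
  assumes "arf_sequence xs"
  shows "semigroup_of xs \<noteq> UNIV"
proof -
  obtain ys m where "xs = ys @ [m]"
    using assms by (metis arf_sequence_def rev_exhaust)
  then have "multiplicity (semigroup_of xs) \<noteq> 1"
    using assms multiplicity_semigroup_of_snoc by (auto simp: arf_sequence_snoc)
  moreover have "multiplicity UNIV = 1"
    unfolding multiplicity_def by (intro Least_equality) auto
  ultimately show ?thesis by metis
qed

section \<open>Iterating the Lipman construction and recovering the sequence\<close>

lemma arf_sequence_take:
  "arf_sequence xs \<Longrightarrow> 0 < n \<Longrightarrow> arf_sequence (take n xs)"
  unfolding arf_sequence_def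
  by (auto simp: sorted_wrt_take min_def)

text \<open>Each application deletes the last entry. Once the list is exhausted, truncated
  subtraction leaves the empty list, whose semigroup \<open>UNIV\<close> is fixed by
  \<open>lipman\<close>.\<close>

lemma lipman_funpow_semigroup_of:
  assumes "arf_sequence xs"
  shows "(lipman ^^ i) (semigroup_of xs) = semigroup_of (take (length xs - i) xs)"
proof (induction i)
  case (Suc i)
  show ?case
  proof (cases "i < length xs")
    case True
    define n where "n = length xs - Suc i"
    have n: "length xs - i = Suc n" "n < length xs" using True by (auto simp: n_def)
    have "arf_sequence (take n xs @ [xs ! n])"
      using arf_sequence_take[OF assms, of "Suc n"] n(2) by (simp add: take_Suc_conv_app_nth)
    then show ?thesis
      using Suc n lipman_semigroup_of_snoc by (simp add: take_Suc_conv_app_nth n_def)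
  next
    case False
    then show ?thesis using Suc by simp
  qed
qed simp

text \<open>Nonempty prefixes are Arf sequences, so their semigroups differ from
  \<open>UNIV\<close>. Thus the length is the first exponent at which the iterates reach
  \<open>UNIV\<close>.\<close>

lemma lipman_funpow_eq_UNIV_iff:
  assumes "arf_sequence xs"
  shows "(lipman ^^ i) (semigroup_of xs) = UNIV \<longleftrightarrow> length xs \<le> i"
proof (cases "length xs \<le> i")
  case False
  then show ?thesis
    using assms semigroup_of_ne_UNIV[OF arf_sequence_take[OF assms, of "length xs - i"]]
    by (simp add: lipman_funpow_semigroup_of)
qed (simp add: lipman_funpow_semigroup_of[OF assms])

lemma lipman_index_iff:
  assumes "arf_sequence xs"
  shows "(lipman ^^ n) (semigroup_of xs) \<subset> (lipman ^^ (n + 1)) (semigroup_of xs) \<and>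
      (lipman ^^ (n + 1)) (semigroup_of xs) = UNIV \<longleftrightarrow> n + 1 = length xs"
proof -
  \<comment> \<open>Given B = \<open>UNIV\<close>, strict inclusion only says that A is not
    \<open>UNIV\<close>, so the previous lemma decides both conjuncts.\<close>
  have *: "A \<subset> B \<and> B = UNIV \<longleftrightarrow> A \<noteq> UNIV \<and> B = UNIV" for A B :: "nat set" by blast
  show ?thesis
    unfolding * unfolding lipman_funpow_eq_UNIV_iff[OF assms] by linarith
qed

text \<open>The entry \<open>xs ! j\<close> is the multiplicity of the semigroup of the prefix of
  length j + 1, which is the iterate with exponent \<open>length xs - Suc j\<close>; hence the
  reversed index list.\<close>

lemma arf_sequence_eq_multiplicities:
  assumes "arf_sequence xs"
  shows "map (\<lambda>i. multiplicity ((lipman ^^ i) (semigroup_of xs))) (rev [0..<length xs]) = xs"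
proof (rule nth_equalityI)
  fix j assume "j < length (map (\<lambda>i. multiplicity ((lipman ^^ i) (semigroup_of xs))) (rev [0..<length xs]))"
  then have j: "j < length xs" by simp
  then have "arf_sequence (take j xs @ [xs ! j])"
    using arf_sequence_take[OF assms, of "Suc j"] by (simp add: take_Suc_conv_app_nth)
  then have "multiplicity (semigroup_of (take (Suc j) xs)) = xs ! j"
    using multiplicity_semigroup_of_snoc j by (simp add: take_Suc_conv_app_nth)
  moreover have "length xs - (length xs - Suc j) = Suc j" using j by simp
  ultimately show "map (\<lambda>i. multiplicity ((lipman ^^ i) (semigroup_of xs))) (rev [0..<length xs]) ! j = xs ! j"
    using j by (simp add: rev_nth lipman_funpow_semigroup_of[OF assms])
qed simp

text \<open>The semigroup determines the length, as the first exponent reaching \<open>UNIV\<close>,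
  and then every entry as a multiplicity.\<close>

lemma inj_on_semigroup_of: "inj_on semigroup_of {xs. arf_sequence xs}"
proof (rule inj_onI, clarify)
  fix xs ys assume *: "arf_sequence xs" "arf_sequence ys" "semigroup_of xs = semigroup_of ys"
  then have "length xs = length ys"
    using lipman_funpow_eq_UNIV_iff[OF *(1), of "length ys"]
      lipman_funpow_eq_UNIV_iff[OF *(1), of "length xs"]
      lipman_funpow_eq_UNIV_iff[OF *(2), of "length ys"]
      lipman_funpow_eq_UNIV_iff[OF *(2), of "length xs"] by simp
  then show "xs = ys"
    by (metis *(3) arf_sequence_eq_multiplicities[OF *(1)] arf_sequence_eq_multiplicities[OF *(2)])
qed

text \<open>Induction on the number of gaps, which drops strictly from S to L(S). Appending the
  multiplicity of S to a sequence for L(S) gives one for S.\<close>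

lemma semigroup_of_surj:
  assumes "arf_numerical_semigroup S" "S \<noteq> UNIV"
  shows "\<exists>xs. arf_sequence xs \<and> semigroup_of xs = S"
  using assms
proof (induction "card (UNIV - S)" arbitrary: S rule: less_induct)
  case less
  note L = arf_numerical_semigroup_lipman[OF less.prems(1)]
  have "card (UNIV - lipman S) < card (UNIV - S)"
    using lipman_strict[OF less.prems] arf_numerical_semigroupD(3)[OF less.prems(1)]
    by (intro psubset_card_mono) auto
  \<comment> \<open>The induction hypothesis excludes L(S) = \<open>UNIV\<close>; the empty list
    covers that case.\<close>
  then have "\<exists>ys. (ys = [] \<or> arf_sequence ys) \<and> semigroup_of ys = lipman S"
    using less.hyps[of "lipman S"] L(1) semigroup_of_Nil by metis
  then obtain ys where ys: "ys = [] \<or> arf_sequence ys" "semigroup_of ys = lipman S" by blast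
  have "2 \<le> multiplicity S"
  proof -
    have "multiplicity S \<noteq> 1"
    proof
      assume "multiplicity S = 1"
      \<comment> \<open>Then 1 = 1 + 0 lies in S, and 1 generates all natural numbers.\<close>
      moreover have "0 \<in> lipman S" using L(1) arf_numerical_semigroupD(1) by blast
      moreover have "n \<in> S" if "1 \<in> S" for n
        using that by (induction n)
          (use arf_numerical_semigroupD(1,2)[OF less.prems(1)] in force)+
      ultimately have "S = UNIV" using L(3) by auto
      with less.prems(2) show False by simp
    qed
    moreover have "0 < multiplicity S"
      using multiplicity_mem(1)[OF arf_numerical_semigroup_imp_numerical_semigroup] less.prems(1)
      by blast
    ultimately show ?thesis by simp
  qed
  then have "arf_sequence (ys @ [multiplicity S])"
    using ys L(2) by (simp add: arf_sequence_snoc)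
  moreover have "semigroup_of (ys @ [multiplicity S]) = S"
    using ys(2) L(3) by (simp add: semigroup_of_snoc)
  ultimately show ?case by blast
qed

theorem corollary2:
  shows "bij_betw semigroup_of
           {xs. arf_sequence xs} ({S. arf_numerical_semigroup S} - {UNIV}) \<and>
         (\<forall>S \<in> {S. arf_numerical_semigroup S} - {UNIV}.
            (\<exists>!n. (lipman ^^ n) S \<subset> (lipman ^^ (n + 1)) S \<and> (lipman ^^ (n + 1)) S = UNIV) \<and>
            (\<forall>n. (lipman ^^ n) S \<subset> (lipman ^^ (n + 1)) S \<and> (lipman ^^ (n + 1)) S = UNIV \<longrightarrow>
               the_inv_into {xs. arf_sequence xs} semigroup_of S =
                 map (\<lambda>i. multiplicity ((lipman ^^ i) S)) (rev [0..<n + 1])))"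
proof (intro conjI ballI)
  show "bij_betw semigroup_of {xs. arf_sequence xs} ({S. arf_numerical_semigroup S} - {UNIV})"
    unfolding bij_betw_def
    using inj_on_semigroup_of semigroup_of_surj arf_numerical_semigroup_semigroup_of
      semigroup_of_ne_UNIV
    by blast
next
  fix S assume "S \<in> {S. arf_numerical_semigroup S} - {UNIV}"
  then obtain xs where xs: "arf_sequence xs" "S = semigroup_of xs"
    using semigroup_of_surj by blast
  then have "xs \<noteq> []" by (simp add: arf_sequence_def)
  then show "\<exists>!n. (lipman ^^ n) S \<subset> (lipman ^^ (n + 1)) S \<and> (lipman ^^ (n + 1)) S = UNIV"
    unfolding xs(2) lipman_index_iff[OF xs(1)]
    \<comment> \<open>As \<open>xs\<close> is nonempty, the subtraction does not truncate, so this
      is the only n with n + 1 = \<open>length xs\<close>.\<close>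
    by (intro ex1I[of _ "length xs - 1"]) (auto simp: Suc_le_eq)
  have "the_inv_into {xs. arf_sequence xs} semigroup_of S = xs"
    using the_inv_into_f_f[OF inj_on_semigroup_of] xs by simp
  then show "\<forall>n. (lipman ^^ n) S \<subset> (lipman ^^ (n + 1)) S \<and> (lipman ^^ (n + 1)) S = UNIV \<longrightarrow>
      the_inv_into {xs. arf_sequence xs} semigroup_of S =
        map (\<lambda>i. multiplicity ((lipman ^^ i) S)) (rev [0..<n + 1])"
    unfolding xs(2) lipman_index_iff[OF xs(1)]
    using arf_sequence_eq_multiplicities[OF xs(1)] by metis
qed

end
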